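(* Let $\gamma(s)=(x(s),y(s))$ be a parametrized curve in $\mathbb{H}^2$ that under the curve shortening flow evolves by geodesic translations along $V=(v,w)$, where $v,w\neq0$ and $v^2+w^2=1$. Then $\gamma$ is an equidistant line of curvature $\kappa=\frac{v}{\sqrt{2(1-w)}}$ and the flow is given by $$\gamma(t,s)=\left(\frac{m(e^{2t}-1)v+2s}{-e^{2t}(w-1)+w+1},\ \frac{2e^{t}\left(m+\frac{s(w-1)}{v}\right)}{-e^{2t}(w-1)+w+1}\right),$$ where $m\in\mathbb{R}$ is an integration constant. Furthermore: (1) the flow is defined for all $t\in\mathbb{R}$, where if $t\to\infty$, then $\gamma_t$ approaches the geodesic $s\mapsto(m,s)$, and if $t\to-\infty$, then $\gamma_t$ approaches the ideal boundary $\mathbb{H}^2_\infty$; (2) for fixed $t$, the solution $\gamma_t$ parametrizes an equidistant line of curvature $\kappa=\frac{v}{\sqrt{v^2+e^{2t}(w-1)^2}}$.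
   Context: $\mathbb{H}^2$ is the upper half-plane $\{(x,y)\in\mathbb{R}^2: y>0\}$ with the metric $\langle\,,\rangle=\frac{dx^2+dy^2}{y^2}$; its ideal boundary $\mathbb{H}^2_\infty=\{y=0\}\cup\{\infty\}$ is the one-point compactification of the line $\{y=0\}$. For a parametrized curve $u\mapsto(x(u),y(u))$, the unit normal is $N=\frac{y}{\sqrt{x'^2+y'^2}}(-y',x')$ and the (geodesic) curvature is $\kappa=y\frac{x'y''-x''y'}{(x'^2+y'^2)^{3/2}}+\frac{x'}{\sqrt{x'^2+y'^2}}$. A one-parameter family of curves $\gamma_t=\gamma(t,\cdot)$ is the curve shortening flow (CSF) of $\gamma$ if $(\partial_t\gamma_t)^\perp=\kappa(t,\cdot)N(t,\cdot)$ and $\gamma_0=\gamma$, where $\kappa(t,\cdot)$ and $N(t,\cdot)$ are the curvature and unit normal of $\gamma_t$ and $\perp$ denotes the normal part. Geodesic translations move each point $p$ along the geodesic $\eta(t)=\eta(t;p,V)$ that passes through $p$ at $t=0$ in the direction $V$. For $p=(x,y)$ and $V=(v,w)$ with $v,w\neq0$, $v^2+w^2=1$, this geodesic is $\eta(t)=\left(x+\frac{(e^{2t}-1)vy}{-e^{2t}w+e^{2t}+w+1},\ \frac{2e^{t}y}{-e^{2t}w+e^{2t}+w+1}\right)$. Thus $\gamma$ evolves under CSF by geodesic translations along $V=(v,w)$ if its flow is $$\gamma(t,s)=\left(\frac{(e^{2t}-1)\,v\,y(s)}{-e^{2t}w+e^{2t}+w+1}+x(s),\ \frac{2e^{t}y(s)}{-e^{2t}w+e^{2t}+w+1}\right).$$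 Geodesics of $\mathbb{H}^2$ are the vertical half-lines from the line $\{y=0\}$ and the half-circles with center on $\{y=0\}$. An equidistant line is a set of points equidistant from a given geodesic; equidistant lines are the non-geodesic arcs of circles and the non-vertical half-lines from points of $\{y=0\}$.
   Formalization: The limit geodesic as t→∞ is s↦(mv/(1-w), s) instead of (m, s); the curvature in (2) carries the factor sgn(v), and that of γ in its own orientation the factor sgn(vφ'), φ being the change of parameter to the displayed flow. *)

theory Defs
  imports "HOL-Analysis.Analysis"
begin

section \<open>The upper half-plane\<close>

definition upper_half_plane :: "(real \<times> real) set" where
  "upper_half_plane = {p. snd p > 0}"

definition hinner :: "real \<times> real \<Rightarrow> real \<times> real \<Rightarrow> real \<times> real \<Rightarrow> real" where
  "hinner p X Y = (X \<bullet> Y) / (snd p)\<^sup>2"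

definition hlength :: "(real \<Rightarrow> real \<times> real) \<Rightarrow> real" where
  "hlength c = integral {0..1}
     (\<lambda>u. sqrt (hinner (c u) (vector_derivative c (at u)) (vector_derivative c (at u))))"

text \<open>
  The Riemannian distance. The competing paths are of class C1 up to the end points. The
  library's \<open>valid_path\<close> would not do: it admits paths whose speed is not integrable, and
  these would get the junk length 0.
\<close>

definition hdist :: "real \<times> real \<Rightarrow> real \<times> real \<Rightarrow> real" where
  "hdist p q = Inf {hlength c | c. c C1_differentiable_on {0..1} \<and>
     c ` {0..1} \<subseteq> upper_half_plane \<and> c 0 = p \<and> c 1 = q}"

definition hdist_set :: "real \<times> real \<Rightarrow> (real \<times> real) set \<Rightarrow> real" where
  "hdist_set p A = (INF q\<in>A. hdist p q)"

definition geodesic :: "(real \<times> real) set \<Rightarrow> bool" where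
  "geodesic g \<longleftrightarrow>
     (\<exists>a. g = {p \<in> upper_half_plane. fst p = a}) \<or>
     (\<exists>a r. r > 0 \<and> g = {p \<in> upper_half_plane. (fst p - a)\<^sup>2 + (snd p)\<^sup>2 = r\<^sup>2})"

text \<open>
  For \<open>d > 0\<close> the points at distance \<open>d\<close> from a geodesic form two curves, one on each side;
  each of them (an arc of a circle or a half-line) is an equidistant line.
\<close>

definition equidistant_line :: "(real \<times> real) set \<Rightarrow> bool" where
  "equidistant_line L \<longleftrightarrow>
     (\<exists>g d. geodesic g \<and> d > 0 \<and> L \<in> components {p \<in> upper_half_plane. hdist_set p g = d})"

text \<open>The closed half-plane together with the point \<open>None\<close> at infinity.\<close>

definition compactified_half_plane :: "(real \<times> real) option topology" where
  "compactified_half_plane = Alexandroff_compactification (top_of_set {p. snd p \<ge> 0})"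

definition ideal_boundary :: "(real \<times> real) option set" where
  "ideal_boundary = insert None (Some ` {p. snd p = 0})"

section \<open>Curves and the curve shortening flow\<close>

definition regular_curve :: "real set \<Rightarrow> (real \<Rightarrow> real \<times> real) \<Rightarrow> bool" where
  "regular_curve I \<gamma> \<longleftrightarrow>
     open I \<and> is_interval I \<and> I \<noteq> {} \<and> \<gamma> ` I \<subseteq> upper_half_plane \<and>
     \<gamma> C1_differentiable_on I \<and> (\<lambda>s. vector_derivative \<gamma> (at s)) C1_differentiable_on I \<and>
     (\<forall>s\<in>I. vector_derivative \<gamma> (at s) \<noteq> 0)"

definition unit_normal :: "(real \<Rightarrow> real \<times> real) \<Rightarrow> real \<Rightarrow> real \<times> real" where
  "unit_normal \<gamma> s =
    (let (x', y') = vector_derivative \<gamma> (at s)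
     in (snd (\<gamma> s) / sqrt (x'\<^sup>2 + y'\<^sup>2)) *\<^sub>R (- y', x'))"

definition curvature :: "(real \<Rightarrow> real \<times> real) \<Rightarrow> real \<Rightarrow> real" where
  "curvature \<gamma> s =
    (let (x', y') = vector_derivative \<gamma> (at s);
         (x'', y'') = vector_derivative (\<lambda>u. vector_derivative \<gamma> (at u)) (at s)
     in snd (\<gamma> s) * (x' * y'' - x'' * y') / sqrt (x'\<^sup>2 + y'\<^sup>2) ^ 3 + x' / sqrt (x'\<^sup>2 + y'\<^sup>2))"

definition normal_part :: "(real \<Rightarrow> real \<times> real) \<Rightarrow> real \<Rightarrow> real \<times> real \<Rightarrow> real \<times> real" where
  "normal_part \<gamma> s X = hinner (\<gamma> s) X (unit_normal \<gamma> s) *\<^sub>R unit_normal \<gamma> s"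

text \<open>
  \<open>J\<close> is any nondegenerate time interval containing 0, for instance \<open>{0..<T}\<close> or \<open>UNIV\<close>; at an
  end point of \<open>J\<close> the time derivative is one-sided.
\<close>

definition curve_shortening_flow ::
  "real set \<Rightarrow> real set \<Rightarrow> (real \<Rightarrow> real \<times> real) \<Rightarrow> (real \<Rightarrow> real \<Rightarrow> real \<times> real) \<Rightarrow> bool" where
  "curve_shortening_flow J I \<gamma> \<Gamma> \<longleftrightarrow>
     is_interval J \<and> 0 \<in> J \<and> interior J \<noteq> {} \<and>
     (\<forall>t\<in>J. regular_curve I (\<Gamma> t)) \<and>
     (\<forall>t\<in>J. \<forall>s\<in>I. (\<lambda>\<tau>. \<Gamma> \<tau> s) differentiable (at t within J) \<and>
        normal_part (\<Gamma> t) s (vector_derivative (\<lambda>\<tau>. \<Gamma> \<tau> s) (at t within J)) =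
        curvature (\<Gamma> t) s *\<^sub>R unit_normal (\<Gamma> t) s) \<and>
     (\<forall>s\<in>I. \<Gamma> 0 s = \<gamma> s)"

definition geodesic_translation :: "real \<Rightarrow> real \<Rightarrow> real \<Rightarrow> real \<times> real \<Rightarrow> real \<times> real" where
  "geodesic_translation v w t p =
    (let D = - exp (2 * t) * w + exp (2 * t) + w + 1
     in ((exp (2 * t) - 1) * v * snd p / D + fst p, 2 * exp t * snd p / D))"

definition evolves_by_geodesic_translations ::
  "real set \<Rightarrow> real set \<Rightarrow> real \<Rightarrow> real \<Rightarrow> (real \<Rightarrow> real \<times> real) \<Rightarrow> bool" where
  "evolves_by_geodesic_translations J I v w \<gamma> \<longleftrightarrow>
     curve_shortening_flow J I \<gamma> (\<lambda>t s. geodesic_translation v w t (\<gamma> s))"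

section \<open>The explicit flow\<close>

definition explicit_flow :: "real \<Rightarrow> real \<Rightarrow> real \<Rightarrow> real \<Rightarrow> real \<Rightarrow> real \<times> real" where
  "explicit_flow v w m t s =
    (let D = - exp (2 * t) * (w - 1) + w + 1
     in ((m * (exp (2 * t) - 1) * v + 2 * s) / D,
         2 * exp t * (m + s * (w - 1) / v) / D))"

text \<open>The largest parameter set on which the curves of the explicit flow lie in the half-plane.\<close>

definition flow_domain :: "real \<Rightarrow> real \<Rightarrow> real \<Rightarrow> real set" where
  "flow_domain v w m = {s. m + s * (w - 1) / v > 0}"

definition change_of_parameter :: "real set \<Rightarrow> (real \<Rightarrow> real) \<Rightarrow> bool" where
  "change_of_parameter I \<phi> \<longleftrightarrow> \<phi> C1_differentiable_on I \<and> (\<forall>s\<in>I. deriv \<phi> s \<noteq> 0)"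

text \<open>Convergence to 0 of the Hausdorff distance with respect to the hyperbolic distance.\<close>

definition approaches_set ::
  "(real \<Rightarrow> (real \<times> real) set) \<Rightarrow> (real \<times> real) set \<Rightarrow> real filter \<Rightarrow> bool" where
  "approaches_set C g F \<longleftrightarrow>
     (\<forall>\<epsilon>>0. \<forall>\<^sub>F t in F. (\<forall>p\<in>C t. hdist_set p g < \<epsilon>) \<and> (\<forall>q\<in>g. hdist_set q (C t) < \<epsilon>))"

text \<open>
  The sets are eventually contained in every neighbourhood of the ideal boundary. They need not
  accumulate at all of its points: a half-line that becomes flat tends to a half of the boundary.
\<close>

definition approaches_ideal_boundary ::
  "(real \<Rightarrow> (real \<times> real) set) \<Rightarrow> real filter \<Rightarrow> bool" where
  "approaches_ideal_boundary C F \<longleftrightarrow>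
     (\<forall>U. openin compactified_half_plane U \<and> ideal_boundary \<subseteq> U \<longrightarrow>
        (\<forall>\<^sub>F t in F. Some ` C t \<subseteq> U))"

end

theory Submission
  imports Defs
begin

text \<open>
  Put \<open>a = 1 - w\<close> and \<open>E = exp t\<close>; then \<open>0 < a < 2\<close> and \<open>v\<^sup>2 = a (2 - a)\<close>. The geodesic translation
  at time \<open>t\<close> is the linear map \<open>(x, y) \<mapsto> (x + c y, d y)\<close> with coefficients depending on \<open>t\<close>, so the
  first and second derivatives of the translated curve are the images of those of \<open>\<gamma>\<close>. Substituted
  into the flow equation, and after clearing positive factors, this gives the condition
  \<open>2 a y (x' y'' - x'' y') = - (E\<^sup>2 q\<^sup>2 + r\<^sup>2) q\<close> with \<open>q = a x' + v y'\<close> and \<open>r = v x' - a y'\<close>,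
  in which time occurs only through \<open>E\<^sup>2\<close> (\<open>translated_curve_flow_equation_iff\<close>). If \<open>q \<noteq> 0\<close> at some
  parameter, the right-hand side is injective in \<open>t\<close> while the left-hand side is constant, which is
  impossible at two different times. Hence \<open>q = 0\<close> (\<open>evolving_curve_tangent\<close>), and \<open>\<gamma>\<close> runs
  in a line \<open>a x + v y = v m\<close>; its abscissa is the change of parameter to the explicit flow.
  Conversely, on such a line both sides vanish at all times (\<open>translated_line_flow\<close>).

  At time \<open>t\<close> the explicit flow fills the half-line \<open>{(x0 + k y, y) | y > 0}\<close> with \<open>x0 = m v / a\<close>
  and \<open>k = - v exp (- t) / a\<close> (\<open>explicit_flow_image\<close>). The hyperbolic distance of \<open>(x, y)\<close> from
  the vertical geodesic over \<open>x0\<close> is \<open>arsinh (\<bar>x - x0\<bar> / y)\<close> (\<open>hdist_set_vertical\<close>), so every such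
  half-line with \<open>k \<noteq> 0\<close> is an equidistant line. As \<open>t \<rightarrow> \<infinity>\<close> we have \<open>k \<rightarrow> 0\<close> and the half-line tends
  to the geodesic; as \<open>t \<rightarrow> -\<infinity>\<close> we have \<open>\<bar>k\<bar> \<rightarrow> \<infinity>\<close>, and \<open>\<bar>x - x0\<bar> / y\<close>, being bounded on compact
  subsets of the open half-plane, forces the half-line out of each of them.
\<close>

section \<open>The distance from a vertical geodesic\<close>

text \<open>
  The parameter is the inverse slope, so that vertical geodesics are the case \<open>k = 0\<close>.
\<close>

definition half_line :: "real \<Rightarrow> real \<Rightarrow> (real \<times> real) set" where
  "half_line x0 k = {p \<in> upper_half_plane. fst p = x0 + k * snd p}"

lemma sqrt_hinner_self:
  assumes "snd p > 0"
  shows "sqrt (hinner p X X) = norm X / snd p"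
  using assms by (simp add: hinner_def real_sqrt_divide norm_eq_sqrt_inner)

lemma hlength_nonneg: "hlength c \<ge> 0"
proof -
  let ?f = "\<lambda>u. sqrt (hinner (c u) (vector_derivative c (at u)) (vector_derivative c (at u)))"
  have "?f u \<ge> 0" for u
    by (simp add: hinner_def)
  then show ?thesis
    unfolding hlength_def
    by (cases "?f integrable_on {0..1}") (auto intro: integral_nonneg simp: not_integrable_integral)
qed

lemma hdist_le_hlength:
  assumes "c C1_differentiable_on {0..1}" "c ` {0..1} \<subseteq> upper_half_plane" "c 0 = p" "c 1 = q"
  shows "hdist p q \<le> hlength c"
  unfolding hdist_def using assms
  by (intro cInf_lower bdd_belowI[where m = 0]) (auto simp: hlength_nonneg)

text \<open>
  Any two points are joined by a segment, so that the infimum defining the distance is taken over a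
  nonempty set and inherits the lower bounds of its members.
\<close>

lemma hdist_greatest:
  assumes "p \<in> upper_half_plane" "q \<in> upper_half_plane"
    and "\<And>c. c C1_differentiable_on {0..1} \<Longrightarrow> c ` {0..1} \<subseteq> upper_half_plane \<Longrightarrow>
           c 0 = p \<Longrightarrow> c 1 = q \<Longrightarrow> B \<le> hlength c"
  shows "B \<le> hdist p q"
proof -
  let ?c = "\<lambda>u. p + u *\<^sub>R (q - p)"
  have "?c C1_differentiable_on {0..1}"
    unfolding C1_differentiable_on_def
    by (intro exI[of _ "\<lambda>_. q - p"]) (auto intro!: derivative_eq_intros)
  moreover have "?c ` {0..1} \<subseteq> upper_half_plane"
  proof -
    have "snd p + u * (snd q - snd p) > 0" if "0 \<le> u" "u \<le> 1" for u
    proof -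
      have "snd p + u * (snd q - snd p) = (1 - u) * snd p + u * snd q"
        by (simp add: algebra_simps)
      moreover have "\<dots> > 0"
        using assms(1,2) that unfolding upper_half_plane_def
        by (cases "u = 0") (auto intro: add_nonneg_pos)
      ultimately show ?thesis by simp
    qed
    then show ?thesis by (auto simp: upper_half_plane_def)
  qed
  moreover have "?c 0 = p" "?c 1 = q"
    by simp_all
  ultimately have "hlength ?c \<in> {hlength c | c. c C1_differentiable_on {0..1} \<and>
      c ` {0..1} \<subseteq> upper_half_plane \<and> c 0 = p \<and> c 1 = q}"
    by blast
  then have "{hlength c | c. c C1_differentiable_on {0..1} \<and>
      c ` {0..1} \<subseteq> upper_half_plane \<and> c 0 = p \<and> c 1 = q} \<noteq> {}"
    by blast
  then show ?thesis
    unfolding hdist_def using assms(3) by (intro cInf_greatest) auto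
qed

lemma hdist_nonneg:
  assumes "p \<in> upper_half_plane" "q \<in> upper_half_plane"
  shows "hdist p q \<ge> 0"
  using assms hlength_nonneg by (intro hdist_greatest)

lemma hdist_set_le_hdist:
  assumes "p \<in> upper_half_plane" "A \<subseteq> upper_half_plane" "q \<in> A"
  shows "hdist_set p A \<le> hdist p q"
  unfolding hdist_set_def using assms
  by (intro cINF_lower bdd_belowI2[where m = 0] hdist_nonneg) auto

lemma sqrt_ratio_square_plus_one:
  fixes x y :: real
  assumes "y > 0"
  shows "sqrt ((x / y)\<^sup>2 + 1) = sqrt (x\<^sup>2 + y\<^sup>2) / y"
proof -
  have "(x / y)\<^sup>2 + 1 = (x\<^sup>2 + y\<^sup>2) / y\<^sup>2"
    using assms by (simp add: field_simps)
  then show ?thesis using assms by (simp add: real_sqrt_divide)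
qed

lemma abs_arsinh: "\<bar>arsinh z\<bar> = arsinh \<bar>z\<bar>" for z :: real
  by (simp add: abs_if)

text \<open>
  The function \<open>(x, y) \<mapsto> arsinh ((x - x0) / y)\<close> is the signed distance from the vertical geodesic
  over \<open>x0\<close>. Its hyperbolic gradient has norm at most 1 by the Cauchy-Schwarz inequality, so along a path
  it changes by no more than the length.
\<close>

lemma arsinh_diff_le_hlength:
  assumes c: "c C1_differentiable_on {0..1}" and up: "c ` {0..1} \<subseteq> upper_half_plane"
  shows "\<bar>arsinh ((fst (c 1) - x0) / snd (c 1)) - arsinh ((fst (c 0) - x0) / snd (c 0))\<bar> \<le> hlength c"
proof -
  obtain c' where c': "\<And>u. u \<in> {0..1} \<Longrightarrow> (c has_vector_derivative c' u) (at u)"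
    and cont: "continuous_on {0..1} c'"
    using c unfolding C1_differentiable_on_def by blast
  have cont_c: "continuous_on {0..1} c"
    using C1_differentiable_imp_continuous_on[OF c] .
  have pos: "snd (c u) > 0" if "u \<in> {0..1}" for u
    using subsetD[OF up imageI[OF that]] by (simp add: upper_half_plane_def)
  define g where "g u = arsinh ((fst (c u) - x0) / snd (c u))" for u
  define g' where "g' u =
    (fst (c' u) * snd (c u) - (fst (c u) - x0) * snd (c' u)) / (snd (c u))\<^sup>2
      / sqrt (((fst (c u) - x0) / snd (c u))\<^sup>2 + 1)" for u
  have deriv: "(g has_vector_derivative g' u) (at u)" if u: "u \<in> {0..1}" for u
  proof -
    have "((\<lambda>u. fst (c u)) has_real_derivative fst (c' u)) (at u)"
      "((\<lambda>u. snd (c u)) has_real_derivative snd (c' u)) (at u)"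
      unfolding has_real_derivative_iff_has_vector_derivative
      using c'[OF u] bounded_linear.has_vector_derivative bounded_linear_fst bounded_linear_snd
      by blast+
    then have "((\<lambda>u. (fst (c u) - x0) / snd (c u)) has_real_derivative
        (fst (c' u) * snd (c u) - (fst (c u) - x0) * snd (c' u)) / (snd (c u))\<^sup>2) (at u)"
      using pos[OF u] by (auto intro!: derivative_eq_intros simp: power2_eq_square)
    from DERIV_chain2[OF arsinh_real_has_field_derivative this] show ?thesis
      unfolding g_def g'_def has_real_derivative_iff_has_vector_derivative[symmetric]
      by (simp add: mult.commute)
  qed
  have speed_bound: "\<bar>g' u\<bar> \<le> norm (c' u) / snd (c u)" if u: "u \<in> {0..1}" for u
  proof -
    obtain X Y where XY: "c' u = (X, Y)" by force
    define x where "x = fst (c u) - x0"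
    define y where "y = snd (c u)"
    have y: "y > 0" using pos[OF u] by (simp add: y_def)
    have R: "sqrt (x\<^sup>2 + y\<^sup>2) > 0" using y by (simp add: sum_power2_gt_zero_iff)
    \<comment> \<open>The difference of the two sides is \<open>(x X + y Y)\<^sup>2\<close>.\<close>
    have "(X * y - x * Y)\<^sup>2 \<le> (X\<^sup>2 + Y\<^sup>2) * (x\<^sup>2 + y\<^sup>2)"
      using zero_le_power2[of "x * X + y * Y"] by (simp add: power2_eq_square algebra_simps)
    then have cauchy: "\<bar>X * y - x * Y\<bar> \<le> sqrt (X\<^sup>2 + Y\<^sup>2) * sqrt (x\<^sup>2 + y\<^sup>2)"
      by (metis real_sqrt_le_iff real_sqrt_abs real_sqrt_mult)
    have "sqrt ((x / y)\<^sup>2 + 1) = sqrt (x\<^sup>2 + y\<^sup>2) / y"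
      by (rule sqrt_ratio_square_plus_one[OF y])
    then have g': "\<bar>g' u\<bar> = \<bar>X * y - x * Y\<bar> / (y * sqrt (x\<^sup>2 + y\<^sup>2))"
      unfolding g'_def XY using y R
      by (simp add: x_def[symmetric] y_def[symmetric] abs_mult power2_eq_square)
    have "\<bar>g' u\<bar> \<le> sqrt (X\<^sup>2 + Y\<^sup>2) * sqrt (x\<^sup>2 + y\<^sup>2) / (y * sqrt (x\<^sup>2 + y\<^sup>2))"
      unfolding g' by (intro divide_right_mono cauchy) (use y in simp)
    then show ?thesis
      using y R by (simp add: XY norm_Pair y_def[symmetric])
  qed
  have "(g' has_integral g 1 - g 0) {0..1}"
    by (rule fundamental_theorem_of_calculus)
      (simp, rule has_vector_derivative_at_within[OF deriv])
  moreover have "(\<lambda>u. norm (c' u) / snd (c u)) integrable_on {0..1}"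
    using pos by (intro integrable_continuous_interval continuous_intros cont cont_c)
      (metis less_irrefl)
  ultimately have "\<bar>g 1 - g 0\<bar> \<le> integral {0..1} (\<lambda>u. norm (c' u) / snd (c u))"
    using integral_norm_bound_integral[of g' "{0..1}" "\<lambda>u. norm (c' u) / snd (c u)"] speed_bound
    by (auto simp: has_integral_iff)
  also have "\<dots> = hlength c"
    unfolding hlength_def
    by (rule integral_cong) (simp add: sqrt_hinner_self[OF pos] vector_derivative_at[OF c'])
  finally show ?thesis unfolding g_def .
qed

lemma hlength_constant_speed:
  assumes c: "\<And>u. (c has_vector_derivative c' u) (at u)"
    and pos: "\<And>u. snd (c u) > 0" and speed: "\<And>u. norm (c' u) = L * snd (c u)"
  shows "hlength c = L"
proof -
  have "hlength c = integral {0..1} (\<lambda>_::real. L)"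
    unfolding hlength_def
    by (rule integral_cong)
      (use pos speed in \<open>simp add: sqrt_hinner_self[OF pos] vector_derivative_at[OF c] less_imp_neq[symmetric]\<close>)
  then show ?thesis by simp
qed

text \<open>
  A horizontal segment is not minimizing, but its length is enough to show that neighbouring
  half-lines are close.
\<close>

lemma hdist_horizontal_le:
  assumes "y > 0"
  shows "hdist (x, y) (x + k * y, y) \<le> \<bar>k\<bar>"
proof -
  let ?c = "\<lambda>u. (x + u * (k * y), y)"
  have c: "(?c has_vector_derivative (k * y, 0)) (at u)" for u
    by (auto intro!: derivative_eq_intros has_vector_derivative_Pair
      simp flip: has_real_derivative_iff_has_vector_derivative)
  have "hdist (x, y) (x + k * y, y) \<le> hlength ?c"
  proof (rule hdist_le_hlength)
    show "?c C1_differentiable_on {0..1}"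
      unfolding C1_differentiable_on_def using c
      by (intro exI[of _ "\<lambda>_. (k * y, 0)"]) auto
  qed (use assms in \<open>auto simp: upper_half_plane_def\<close>)
  also have "hlength ?c = \<bar>k\<bar>"
    by (rule hlength_constant_speed[OF c]) (use assms in \<open>auto simp: norm_Pair abs_mult\<close>)
  finally show ?thesis .
qed

text \<open>
  The perpendicular from a point to the vertical geodesic is an arc of the circle about \<open>(x0, 0)\<close>
  with radius \<open>R\<close>. It is parametrized at constant speed by
  \<open>(x0 + R tanh z, R / cosh z)\<close>, which has hyperbolic unit speed in \<open>z\<close>.
\<close>

lemma hdist_foot_le:
  assumes "y > 0"
  shows "hdist (x0 + x, y) (x0, sqrt (x\<^sup>2 + y\<^sup>2)) \<le> arsinh (\<bar>x\<bar> / y)"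
proof -
  define R where "R = sqrt (x\<^sup>2 + y\<^sup>2)"
  define T where "T = arsinh (x / y)"
  have R: "R > 0" using assms by (simp add: R_def sum_power2_gt_zero_iff)
  have sinhT: "sinh T = x / y" by (simp add: T_def)
  have "cosh T = sqrt ((x / y)\<^sup>2 + 1)" by (simp add: T_def cosh_arsinh_real)
  also have "\<dots> = R / y"
    unfolding R_def by (rule sqrt_ratio_square_plus_one[OF assms])
  finally have coshT: "cosh T = R / y" .
  let ?c = "\<lambda>u. (x0 + R * tanh ((1 - u) * T), R / cosh ((1 - u) * T))"
  let ?c' = "\<lambda>u. (- R * T / (cosh ((1 - u) * T))\<^sup>2,
                  R * T * sinh ((1 - u) * T) / (cosh ((1 - u) * T))\<^sup>2)"
  have c: "(?c has_vector_derivative ?c' u) (at u)" for u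
  proof (rule has_vector_derivative_Pair)
    have "1 - (tanh z)\<^sup>2 = 1 / (cosh z)\<^sup>2" for z :: real
      by (simp add: tanh_def power_divide sinh_square_eq diff_divide_distrib)
    then show "((\<lambda>u. x0 + R * tanh ((1 - u) * T)) has_vector_derivative
        - R * T / (cosh ((1 - u) * T))\<^sup>2) (at u)"
      unfolding has_real_derivative_iff_has_vector_derivative[symmetric]
      by (auto intro!: derivative_eq_intros)
    show "((\<lambda>u. R / cosh ((1 - u) * T)) has_vector_derivative
        R * T * sinh ((1 - u) * T) / (cosh ((1 - u) * T))\<^sup>2) (at u)"
      unfolding has_real_derivative_iff_has_vector_derivative[symmetric]
      by (auto intro!: derivative_eq_intros simp: power2_eq_square)
  qed
  have "hdist (x0 + x, y) (x0, R) \<le> hlength ?c"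
  proof (rule hdist_le_hlength)
    show "?c C1_differentiable_on {0..1}"
      unfolding C1_differentiable_on_def using c
      by (intro exI[of _ ?c'] conjI ballI) (auto intro!: continuous_intros)
    show "?c ` {0..1} \<subseteq> upper_half_plane"
      using R by (auto simp: upper_half_plane_def)
    show "?c 0 = (x0 + x, y)"
      using R assms by (simp add: tanh_def sinhT coshT)
  qed simp
  also have "hlength ?c = \<bar>T\<bar>"
  proof (rule hlength_constant_speed[OF c])
    show "norm (?c' u) = \<bar>T\<bar> * snd (?c u)" for u
    proof -
      let ?z = "(1 - u) * T"
      have "norm (?c' u) = sqrt ((R * T / cosh ?z)\<^sup>2)"
        unfolding norm_Pair real_norm_def power2_abs
        by (rule arg_cong[of _ _ sqrt])
          (simp add: power_divide power_mult_distrib sinh_square_eq divide_simps, simp add: algebra_simps)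
      also have "\<dots> = \<bar>T\<bar> * snd (?c u)"
        using R by (simp add: abs_mult)
      finally show ?thesis .
    qed
  qed (use R in auto)
  also have "\<bar>T\<bar> = arsinh (\<bar>x\<bar> / y)"
    using assms by (simp add: T_def abs_arsinh)
  finally show ?thesis unfolding R_def .
qed

lemma hdist_set_vertical:
  assumes "p \<in> upper_half_plane"
  shows "hdist_set p (half_line x0 0) = arsinh (\<bar>fst p - x0\<bar> / snd p)"
proof -
  obtain x y where p: "p = (x0 + x, y)"
    by (metis add.commute diff_add_cancel surj_pair)
  have y: "y > 0" using assms by (simp add: p upper_half_plane_def)
  have q: "(x0, sqrt (x\<^sup>2 + y\<^sup>2)) \<in> half_line x0 0"
    using y by (auto simp: half_line_def upper_half_plane_def sum_power2_gt_zero_iff)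
  have upper: "hdist_set p (half_line x0 0) \<le> arsinh (\<bar>x\<bar> / y)"
    using hdist_set_le_hdist[OF assms _ q] hdist_foot_le[OF y, of x0 x]
    unfolding p half_line_def by force
  have lower: "arsinh (\<bar>x\<bar> / y) \<le> hdist p q" if "q \<in> half_line x0 0" for q
  proof (rule hdist_greatest)
    fix c :: "real \<Rightarrow> real \<times> real"
    assume c: "c C1_differentiable_on {0..1}" "c ` {0..1} \<subseteq> upper_half_plane" "c 0 = p" "c 1 = q"
    have "\<bar>arsinh (x / y)\<bar> \<le> hlength c"
      using arsinh_diff_le_hlength[OF c(1,2), of x0] c(3,4) that
      by (simp add: p half_line_def)
    then show "arsinh (\<bar>x\<bar> / y) \<le> hlength c"
      using y by (simp add: abs_arsinh)
  qed (use assms that in \<open>auto simp: half_line_def\<close>)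
  have "arsinh (\<bar>x\<bar> / y) \<le> hdist_set p (half_line x0 0)"
    unfolding hdist_set_def using lower q by (intro cINF_greatest) auto
  with upper show ?thesis by (simp add: p)
qed

section \<open>Equidistant half-lines and their limits\<close>

lemma geodesic_vertical: "geodesic (half_line x0 0)"
  by (auto simp: geodesic_def half_line_def)

lemma convex_half_line: "convex (half_line x0 k)"
proof -
  have "half_line x0 k = {p. snd p > 0} \<inter> {p. fst p - k * snd p = x0}"
    by (auto simp: half_line_def upper_half_plane_def)
  moreover have "convex {p::real\<times>real. snd p > 0}"
    using convex_halfspace_gt[of 0 "(0::real, 1::real)"] by (simp add: inner_prod_def)
  moreover have "convex {p::real\<times>real. fst p - k * snd p = x0}"
    using convex_hyperplane[of "(1::real, -k)" x0] by (simp add: inner_prod_def)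
  ultimately show ?thesis by (simp add: convex_Int)
qed

text \<open>
  The points at distance \<open>arsinh \<bar>k\<bar>\<close> form the two half-lines with inverse slopes \<open>k\<close> and \<open>- k\<close>, which the
  vertical line over \<open>x0\<close> separates; hence each of them is a component.
\<close>

lemma equidistant_line_half_line:
  assumes k: "k \<noteq> 0"
  shows "equidistant_line (half_line x0 k)"
proof -
  let ?S = "{p \<in> upper_half_plane. hdist_set p (half_line x0 0) = arsinh \<bar>k\<bar>}"
  have S: "p \<in> ?S \<longleftrightarrow> p \<in> half_line x0 k \<or> p \<in> half_line x0 (- k)" for p
  proof (cases "p \<in> upper_half_plane")
    case True
    then have y: "snd p > 0" by (simp add: upper_half_plane_def)
    have "hdist_set p (half_line x0 0) = arsinh \<bar>k\<bar> \<longleftrightarrow> \<bar>fst p - x0\<bar> / snd p = \<bar>k\<bar>"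
      unfolding hdist_set_vertical[OF True] by (metis sinh_arsinh_real)
    also have "\<dots> \<longleftrightarrow> \<bar>fst p - x0\<bar> = \<bar>k * snd p\<bar>"
      using y by (auto simp: field_simps abs_mult)
    also have "\<dots> \<longleftrightarrow> fst p = x0 + k * snd p \<or> fst p = x0 + - k * snd p"
      by (auto simp: abs_eq_iff)
    finally show ?thesis using True by (simp add: half_line_def)
  qed (simp add: half_line_def)
  have "half_line x0 k \<in> components ?S"
    unfolding in_components_maximal
  proof (intro conjI allI impI)
    have "(x0 + k, 1) \<in> half_line x0 k" by (simp add: half_line_def upper_half_plane_def)
    then show ne: "half_line x0 k \<noteq> {}" by blast
    show "half_line x0 k \<subseteq> ?S" using S by blast
    show "connected (half_line x0 k)" by (rule convex_connected[OF convex_half_line])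
    fix C assume C: "C \<noteq> {} \<and> half_line x0 k \<subseteq> C \<and> C \<subseteq> ?S \<and> connected C"
    let ?P = "{p::real\<times>real. k * (fst p - x0) > 0}" and ?N = "{p::real\<times>real. k * (fst p - x0) < 0}"
    have sides: "half_line x0 k \<subseteq> ?P" "half_line x0 (- k) \<subseteq> ?N"
      using k by (auto simp: half_line_def upper_half_plane_def zero_less_mult_iff mult_less_0_iff)
    have CS: "C \<subseteq> half_line x0 k \<union> half_line x0 (- k)"
      using C S by blast
    have "open ?P" "open ?N"
      by (intro open_Collect_less continuous_intros)+
    then have "?P \<inter> C = {} \<or> ?N \<inter> C = {}"
      using C CS sides by (intro connectedD[of C]) auto
    moreover have "?P \<inter> C \<noteq> {}"
      using C ne sides by blast
    ultimately have "C \<subseteq> half_line x0 k"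
      using CS sides by blast
    then show "C = half_line x0 k" using C by blast
  qed
  moreover have "arsinh \<bar>k\<bar> > 0" using k by simp
  ultimately show ?thesis
    unfolding equidistant_line_def using geodesic_vertical by blast
qed

lemma approaches_set_vertical:
  assumes k: "(k \<longlongrightarrow> 0) F"
  shows "approaches_set (\<lambda>t. half_line x0 (k t)) (half_line x0 0) F"
  unfolding approaches_set_def
proof (intro allI impI)
  fix \<epsilon> :: real assume "\<epsilon> > 0"
  have "((\<lambda>t. arsinh \<bar>k t\<bar>) \<longlongrightarrow> arsinh \<bar>0\<bar>) F"
    by (intro tendsto_intros k)
  then have "\<forall>\<^sub>F t in F. arsinh \<bar>k t\<bar> < \<epsilon>"
    using \<open>\<epsilon> > 0\<close> by (auto dest: order_tendstoD(2))
  moreover have "\<forall>\<^sub>F t in F. \<bar>k t\<bar> < \<epsilon>"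
    using tendsto_rabs_zero[OF k] \<open>\<epsilon> > 0\<close> by (auto dest: order_tendstoD(2))
  ultimately show "\<forall>\<^sub>F t in F. (\<forall>p\<in>half_line x0 (k t). hdist_set p (half_line x0 0) < \<epsilon>) \<and>
      (\<forall>q\<in>half_line x0 0. hdist_set q (half_line x0 (k t)) < \<epsilon>)"
  proof eventually_elim
    case (elim t)
    have "hdist_set p (half_line x0 0) < \<epsilon>" if "p \<in> half_line x0 (k t)" for p
    proof -
      have "p \<in> upper_half_plane" "\<bar>fst p - x0\<bar> / snd p = \<bar>k t\<bar>"
        using that by (auto simp: half_line_def upper_half_plane_def abs_mult)
      then show ?thesis using elim by (simp add: hdist_set_vertical)
    qed
    moreover have "hdist_set q (half_line x0 (k t)) < \<epsilon>" if "q \<in> half_line x0 0" for q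
    proof -
      define y where "y = snd q"
      have q: "q = (x0, y)" "y > 0"
        using that by (auto simp: y_def half_line_def upper_half_plane_def prod_eq_iff)
      have "hdist_set q (half_line x0 (k t)) \<le> hdist q (x0 + k t * y, y)"
        using q by (intro hdist_set_le_hdist) (auto simp: half_line_def upper_half_plane_def)
      then show ?thesis using hdist_horizontal_le[of y x0 "k t"] q elim by simp
    qed
    ultimately show ?case by blast
  qed
qed

text \<open>
  The complement of a neighbourhood of the ideal boundary is a compact subset \<open>K\<close> of the open
  half-plane. The continuous function \<open>\<bar>x - x0\<bar> / y\<close> is bounded on \<open>K\<close> and has the constant value
  \<open>\<bar>k\<bar>\<close> on the half-line, so a half-line with large \<open>\<bar>k\<bar>\<close> misses \<open>K\<close>.
\<close>

lemma approaches_ideal_boundary_half_line: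
  assumes k: "filterlim (\<lambda>t. \<bar>k t\<bar>) at_top F"
  shows "approaches_ideal_boundary (\<lambda>t. half_line x0 (k t)) F"
  unfolding approaches_ideal_boundary_def
proof (intro allI impI)
  fix U assume U: "openin compactified_half_plane U \<and> ideal_boundary \<subseteq> U"
  have "None \<in> U" using U by (auto simp: ideal_boundary_def)
  then obtain K where K: "compactin (top_of_set {p::real\<times>real. snd p \<ge> 0}) K"
    and UK: "U = insert None (Some ` ({p. snd p \<ge> 0} - K))"
    using U unfolding compactified_half_plane_def openin_Alexandroff_compactification
    by auto
  have cK: "compact K" and Kpos: "snd p > 0" if "p \<in> K" for p
  proof -
    show "compact K" using K by (simp add: compactin_subtopology)
    have "snd p \<noteq> 0"
    proof
      assume "snd p = 0"
      then have "Some p \<in> U" using U by (auto simp: ideal_boundary_def)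
      then show False using UK that by auto
    qed
    moreover have "snd p \<ge> 0" using K that by (auto simp: compactin_subtopology)
    ultimately show "snd p > 0" by simp
  qed
  show "\<forall>\<^sub>F t in F. Some ` half_line x0 (k t) \<subseteq> U"
  proof -
    have "\<exists>B. \<forall>p\<in>K. \<bar>fst p - x0\<bar> / snd p < B"
    proof (cases "K = {}")
      case False
      then have cK: "compact K" using cK by blast
      have "continuous_on K (\<lambda>p. \<bar>fst p - x0\<bar> / snd p)"
        using Kpos by (intro continuous_intros) (metis less_irrefl)
      then have "bounded ((\<lambda>p. \<bar>fst p - x0\<bar> / snd p) ` K)"
        using cK by (intro compact_imp_bounded compact_continuous_image)
      then obtain B where B: "\<And>p. p \<in> K \<Longrightarrow> \<bar>\<bar>fst p - x0\<bar> / snd p\<bar> \<le> B"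
        unfolding bounded_iff by auto
      show ?thesis
        by (intro exI[of _ "B + 1"] ballI) (use B abs_le_D1 in \<open>smt (verit)\<close>)
    qed auto
    then obtain B where B: "\<And>p. p \<in> K \<Longrightarrow> \<bar>fst p - x0\<bar> / snd p < B" by blast
    have "\<forall>\<^sub>F t in F. \<bar>k t\<bar> \<ge> B"
      using k by (simp add: filterlim_at_top)
    then show ?thesis
    proof eventually_elim
      case (elim t)
      have "p \<notin> K" if "p \<in> half_line x0 (k t)" for p
        using that B[of p] elim by (auto simp: half_line_def upper_half_plane_def abs_mult)
      then show ?case
        unfolding UK by (auto simp: half_line_def upper_half_plane_def)
    qed
  qed
qed

section \<open>Twice differentiable curves\<close>

text \<open>
  Naming the derivatives makes them computable: the second derivative in the definition of the curvature
  is the derivative of \<open>\<lambda>u. vector_derivative \<gamma> (at u)\<close>, a function that is known only on \<open>I\<close>.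
\<close>

definition C2_derivatives ::
  "real set \<Rightarrow> (real \<Rightarrow> real \<times> real) \<Rightarrow> (real \<Rightarrow> real \<times> real) \<Rightarrow> (real \<Rightarrow> real \<times> real) \<Rightarrow> bool" where
  "C2_derivatives I \<gamma> \<gamma>' \<gamma>'' \<longleftrightarrow>
     (\<forall>s\<in>I. (\<gamma> has_vector_derivative \<gamma>' s) (at s) \<and> (\<gamma>' has_vector_derivative \<gamma>'' s) (at s)) \<and>
     continuous_on I \<gamma>''"

lemma vector_derivative_C2:
  assumes "C2_derivatives I \<gamma> \<gamma>' \<gamma>''" "s \<in> I"
  shows "vector_derivative \<gamma> (at s) = \<gamma>' s"
  using assms by (auto simp: C2_derivatives_def intro: vector_derivative_at)

lemma has_second_vector_derivative_C2:
  assumes "open I" "C2_derivatives I \<gamma> \<gamma>' \<gamma>''" "s \<in> I"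
  shows "((\<lambda>u. vector_derivative \<gamma> (at u)) has_vector_derivative \<gamma>'' s) (at s)"
proof (rule has_vector_derivative_transform_within_open[of \<gamma>' _ _ I])
  show "(\<gamma>' has_vector_derivative \<gamma>'' s) (at s)"
    using assms by (simp add: C2_derivatives_def)
qed (use assms in \<open>auto simp: vector_derivative_C2\<close>)

lemma C2_derivatives_cong:
  assumes "open I" "C2_derivatives I \<gamma> \<gamma>' \<gamma>''" "\<And>s. s \<in> I \<Longrightarrow> \<delta> s = \<gamma> s"
  shows "C2_derivatives I \<delta> \<gamma>' \<gamma>''"
  using assms unfolding C2_derivatives_def
  by (metis (no_types, lifting) has_vector_derivative_transform_within_open)

lemma C2_derivatives_bounded_linear:
  assumes "bounded_linear A" "C2_derivatives I \<gamma> \<gamma>' \<gamma>''"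
  shows "C2_derivatives I (\<lambda>s. A (\<gamma> s)) (\<lambda>s. A (\<gamma>' s)) (\<lambda>s. A (\<gamma>'' s))"
  using assms unfolding C2_derivatives_def
  by (auto intro: bounded_linear.has_vector_derivative bounded_linear.continuous_on)

lemma regular_curve_iff_C2:
  "regular_curve I \<gamma> \<longleftrightarrow> open I \<and> is_interval I \<and> I \<noteq> {} \<and> \<gamma> ` I \<subseteq> upper_half_plane \<and>
     (\<exists>\<gamma>' \<gamma>''. C2_derivatives I \<gamma> \<gamma>' \<gamma>'' \<and> (\<forall>s\<in>I. \<gamma>' s \<noteq> 0))"
proof (cases "open I")
  case I: True
  show ?thesis
  proof
    assume reg: "regular_curve I \<gamma>"
    let ?\<gamma>' = "\<lambda>s. vector_derivative \<gamma> (at s)"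
    obtain \<gamma>'' where "\<forall>s\<in>I. (?\<gamma>' has_vector_derivative \<gamma>'' s) (at s)" "continuous_on I \<gamma>''"
      using reg unfolding regular_curve_def C1_differentiable_on_def by blast
    moreover have "(\<gamma> has_vector_derivative ?\<gamma>' s) (at s)" if "s \<in> I" for s
      using reg that unfolding regular_curve_def C1_differentiable_on_def
      by (metis vector_derivative_at)
    ultimately have "C2_derivatives I \<gamma> ?\<gamma>' \<gamma>''"
      by (simp add: C2_derivatives_def)
    then show "open I \<and> is_interval I \<and> I \<noteq> {} \<and> \<gamma> ` I \<subseteq> upper_half_plane \<and>
     (\<exists>\<gamma>' \<gamma>''. C2_derivatives I \<gamma> \<gamma>' \<gamma>'' \<and> (\<forall>s\<in>I. \<gamma>' s \<noteq> 0))"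
      using reg unfolding regular_curve_def by blast
  next
    assume R: "open I \<and> is_interval I \<and> I \<noteq> {} \<and> \<gamma> ` I \<subseteq> upper_half_plane \<and>
     (\<exists>\<gamma>' \<gamma>''. C2_derivatives I \<gamma> \<gamma>' \<gamma>'' \<and> (\<forall>s\<in>I. \<gamma>' s \<noteq> 0))"
    then obtain \<gamma>' \<gamma>'' where C2: "C2_derivatives I \<gamma> \<gamma>' \<gamma>''" and nz: "\<forall>s\<in>I. \<gamma>' s \<noteq> 0"
      by blast
    have "continuous_on I \<gamma>'"
      using C2 unfolding C2_derivatives_def
      by (metis continuous_at_imp_continuous_on has_vector_derivative_continuous)
    then have "\<gamma> C1_differentiable_on I"
      using C2 unfolding C1_differentiable_on_def C2_derivatives_def by blast
    moreover have "(\<lambda>s. vector_derivative \<gamma> (at s)) C1_differentiable_on I"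
      using C2 has_second_vector_derivative_C2[OF I C2]
      unfolding C1_differentiable_on_def C2_derivatives_def by blast
    ultimately show "regular_curve I \<gamma>"
      using R nz vector_derivative_C2[OF C2] unfolding regular_curve_def by simp
  qed
qed (simp add: regular_curve_def)

lemma curvature_C2:
  assumes "open I" "C2_derivatives I \<gamma> \<gamma>' \<gamma>''" "s \<in> I" "\<gamma>' s = (x1, y1)" "\<gamma>'' s = (x2, y2)"
  shows "curvature \<gamma> s =
    snd (\<gamma> s) * (x1 * y2 - x2 * y1) / sqrt (x1\<^sup>2 + y1\<^sup>2) ^ 3 + x1 / sqrt (x1\<^sup>2 + y1\<^sup>2)"
  using assms vector_derivative_C2[OF assms(2,3)]
    vector_derivative_at[OF has_second_vector_derivative_C2[OF assms(1-3)]]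
  by (simp add: curvature_def)

text \<open>
  Both sides of the flow equation are multiples of the nonzero unit normal, so it is an equation
  between real numbers; multiplied by \<open>y L\<^sup>3\<close>, where \<open>L\<close> is the Euclidean speed, it becomes polynomial.
\<close>

lemma normal_velocity_eq_curvature_iff:
  assumes "open I" "C2_derivatives I \<gamma> \<gamma>' \<gamma>''" "s \<in> I"
    and d: "\<gamma>' s = (x1, y1)" "\<gamma>'' s = (x2, y2)" and nz: "(x1, y1) \<noteq> (0, 0)"
    and y: "snd (\<gamma> s) = y" "y > 0"
  shows "normal_part \<gamma> s X = curvature \<gamma> s *\<^sub>R unit_normal \<gamma> s \<longleftrightarrow>
    (x1 * snd X - y1 * fst X) * (x1\<^sup>2 + y1\<^sup>2) = y\<^sup>2 * (x1 * y2 - x2 * y1) + y * x1 * (x1\<^sup>2 + y1\<^sup>2)"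
proof -
  define L where "L = sqrt (x1\<^sup>2 + y1\<^sup>2)"
  have L: "L > 0" using nz by (auto simp: L_def sum_power2_gt_zero_iff)
  have L2: "x1\<^sup>2 + y1\<^sup>2 = L\<^sup>2" by (simp add: L_def)
  have N: "unit_normal \<gamma> s = (y / L) *\<^sub>R (- y1, x1)"
    using vector_derivative_C2[OF assms(2,3)] d y by (simp add: unit_normal_def L_def)
  have N0: "unit_normal \<gamma> s \<noteq> 0"
    using nz L y unfolding N by (auto simp: zero_prod_def)
  have inner: "hinner (\<gamma> s) X (unit_normal \<gamma> s) = (x1 * snd X - y1 * fst X) / (y * L)"
    unfolding N using L y by (simp add: hinner_def inner_prod_def power2_eq_square field_simps)
  have "normal_part \<gamma> s X = curvature \<gamma> s *\<^sub>R unit_normal \<gamma> s \<longleftrightarrow>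
      (x1 * snd X - y1 * fst X) / (y * L) = y * (x1 * y2 - x2 * y1) / L ^ 3 + x1 / L"
    unfolding normal_part_def inner curvature_C2[OF assms(1-3) d] y(1) L_def[symmetric]
    using N0 by simp
  also have "\<dots> \<longleftrightarrow> (x1 * snd X - y1 * fst X) * L\<^sup>2 = y\<^sup>2 * (x1 * y2 - x2 * y1) + y * x1 * L\<^sup>2"
  proof -
    have "(x1 * snd X - y1 * fst X) / (y * L) = (x1 * snd X - y1 * fst X) * L\<^sup>2 / (y * L ^ 3)"
      using L by (simp add: power2_eq_square power3_eq_cube)
    moreover have "y * (x1 * y2 - x2 * y1) / L ^ 3 + x1 / L =
        (y\<^sup>2 * (x1 * y2 - x2 * y1) + y * x1 * L\<^sup>2) / (y * L ^ 3)"
      using L y by (simp add: add_divide_distrib power2_eq_square power3_eq_cube)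
    ultimately show ?thesis
      using L y by (metis divide_cancel_right less_irrefl mult_eq_0_iff power_eq_0_iff)
  qed
  finally show ?thesis unfolding L2 .
qed

section \<open>The flow equation for translated curves\<close>

definition translation_denominator :: "real \<Rightarrow> real \<Rightarrow> real" where
  "translation_denominator w t = exp (2 * t) * (1 - w) + (1 + w)"

definition shear :: "real \<Rightarrow> real \<Rightarrow> real \<Rightarrow> real" where
  "shear v w t = (exp (2 * t) - 1) * v / translation_denominator w t"

definition dilation :: "real \<Rightarrow> real \<Rightarrow> real" where
  "dilation w t = 2 * exp t / translation_denominator w t"

lemma geodesic_translation_eq:
  "geodesic_translation v w t p = (fst p + shear v w t * snd p, dilation w t * snd p)"
  by (simp add: geodesic_translation_def translation_denominator_def shear_def dilation_def
      Let_def algebra_simps)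

lemma bounded_linear_geodesic_translation: "bounded_linear (geodesic_translation v w t)"
  unfolding geodesic_translation_eq[abs_def]
  by (intro bounded_linear_Pair bounded_linear_add bounded_linear_fst
      bounded_linear_const_mult bounded_linear_snd)

text \<open>
  The algebraic core. Here \<open>c\<close> and \<open>d\<close> are the coefficients of the geodesic translation at
  \<open>E = exp t\<close>; their time derivatives are \<open>v d\<^sup>2\<close> and \<open>d e\<close>. Two identities separate time from the
  curve: the normal velocity minus the first-order term \<open>x' / L\<close> of the curvature, for the translated
  curve of Euclidean speed \<open>L\<close>, is a multiple of \<open>q = a x1 + v y1\<close>; and \<open>a D L\<^sup>2 = E\<^sup>2 q\<^sup>2 + r\<^sup>2\<close> with
  \<open>r = v x1 - a y1\<close>. The latter needs \<open>v\<^sup>2 = a (2 - a)\<close>, which for \<open>a = 1 - w\<close> says that \<open>(v, w)\<close> is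
  a unit vector.
\<close>

lemma translated_equation_iff:
  fixes a v E y x1 y1 x2 y2 :: real
  defines "D \<equiv> a * E\<^sup>2 + (2 - a)"
  defines "c \<equiv> (E\<^sup>2 - 1) * v / D" and "d \<equiv> 2 * E / D" and "e \<equiv> (2 - a - a * E\<^sup>2) / D"
  assumes v: "v\<^sup>2 = a * (2 - a)" and pos: "a > 0" "D > 0" "E > 0" "y > 0"
  shows "((x1 + c * y1) * (d * e * y) - (d * y1) * (v * d\<^sup>2 * y)) * ((x1 + c * y1)\<^sup>2 + (d * y1)\<^sup>2) =
      (d * y)\<^sup>2 * ((x1 + c * y1) * (d * y2) - (x2 + c * y2) * (d * y1)) +
      (d * y) * (x1 + c * y1) * ((x1 + c * y1)\<^sup>2 + (d * y1)\<^sup>2) \<longleftrightarrow>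
    2 * a * y * (x1 * y2 - x2 * y1) =
      - ((E\<^sup>2 * (a * x1 + v * y1)\<^sup>2 + (v * x1 - a * y1)\<^sup>2) * (a * x1 + v * y1))"
    (is "?L = ?R \<longleftrightarrow> ?goal")
proof -
  define X where "X = x1 + c * y1"
  define S where "S = X\<^sup>2 + (d * y1)\<^sup>2"
  define q where "q = a * x1 + v * y1"
  define r where "r = v * x1 - a * y1"
  define W where "W = x1 * y2 - x2 * y1"
  have DX: "D * X = D * x1 + (E\<^sup>2 - 1) * v * y1" and Dd: "D * d = 2 * E"
    and De: "D * e = 2 - a - a * E\<^sup>2"
    using pos by (simp_all add: X_def c_def d_def e_def distrib_left)
  have speed: "a * D * S = E\<^sup>2 * q\<^sup>2 + r\<^sup>2"
  proof -
    have "D * (a * D * S) = a * ((D * X)\<^sup>2 + (D * d * y1)\<^sup>2)"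
      by (simp add: S_def power2_eq_square algebra_simps)
    also have "\<dots> = a * ((D * x1 + (E\<^sup>2 - 1) * v * y1)\<^sup>2 + (2 * E * y1)\<^sup>2)"
      by (simp only: DX Dd)
    also have "\<dots> = D * (E\<^sup>2 * q\<^sup>2 + r\<^sup>2)"
      using v unfolding q_def r_def D_def by algebra
    finally show ?thesis using pos by simp
  qed
  have "D\<^sup>2 * ((e - 1) * X - v * d\<^sup>2 * y1) = (D * e - D) * (D * X) - v * (D * d)\<^sup>2 * y1"
    by (simp add: power2_eq_square algebra_simps)
  also have "\<dots> = (2 - a - a * E\<^sup>2 - D) * (D * x1 + (E\<^sup>2 - 1) * v * y1) - v * (2 * E)\<^sup>2 * y1"
    by (simp only: DX Dd De)
  also have "\<dots> = - ((2 * E)\<^sup>2 * (D * q / 2))"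
    unfolding q_def D_def by (simp add: power2_eq_square field_simps)
  also have "\<dots> = D\<^sup>2 * (- (d\<^sup>2 * (D * q / 2)))"
    unfolding Dd[symmetric] by (simp add: power_mult_distrib)
  finally have "D\<^sup>2 * ((e - 1) * X - v * d\<^sup>2 * y1) = D\<^sup>2 * - (d\<^sup>2 * (D * q / 2))" .
  then have velocity: "(e - 1) * X - v * d\<^sup>2 * y1 = - (d\<^sup>2 * (D * q / 2))"
    using pos(2) by (subst (asm) mult_left_cancel) simp_all
  have "?L - ?R = d * y * (((e - 1) * X - v * d\<^sup>2 * y1) * S - d\<^sup>2 * y * W)"
    unfolding X_def[symmetric] S_def[symmetric]
    by (simp add: W_def X_def power2_eq_square algebra_simps)
  then have "2 * a * (?L - ?R) = 2 * a * (d * y * (- (d\<^sup>2 * (D * q / 2)) * S - d\<^sup>2 * y * W))"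
    by (simp only: velocity)
  also have "\<dots> = - (d ^ 3 * y) * (2 * a * y * W + (a * D * S) * q)"
    by (simp add: power2_eq_square power3_eq_cube field_simps)
  finally have "?L = ?R \<longleftrightarrow> 2 * a * y * W + (E\<^sup>2 * q\<^sup>2 + r\<^sup>2) * q = 0"
    unfolding speed using pos by (auto simp: d_def)
  then show ?thesis
    unfolding q_def r_def W_def by (simp add: eq_neg_iff_add_eq_0)
qed

lemma line_tangent:
  assumes "open I" "C2_derivatives I \<gamma> \<gamma>' \<gamma>''"
    and line: "\<And>s. s \<in> I \<Longrightarrow> a * fst (\<gamma> s) + b * snd (\<gamma> s) = C" and "s \<in> I"
  shows "a * fst (\<gamma>' s) + b * snd (\<gamma>' s) = 0"
    and "a * fst (\<gamma>'' s) + b * snd (\<gamma>'' s) = 0"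
proof -
  let ?A = "\<lambda>p. a * fst p + b * snd p :: real"
  have A: "bounded_linear ?A"
    by (intro bounded_linear_add bounded_linear_const_mult bounded_linear_fst bounded_linear_snd)
  have zero: "?A (f' s) = 0"
    if f: "(f has_vector_derivative f' s) (at s)" and c: "\<And>s. s \<in> I \<Longrightarrow> ?A (f s) = c"
      and "s \<in> I" for f f' c s
  proof (rule vector_derivative_unique_at)
    show "((\<lambda>s. ?A (f s)) has_vector_derivative ?A (f' s)) (at s)"
      by (rule bounded_linear.has_vector_derivative[OF A f])
    show "((\<lambda>s. ?A (f s)) has_vector_derivative 0) (at s)"
      by (rule has_vector_derivative_transform_within_open[of "\<lambda>_. c" _ _ I])
        (use that assms(1) in auto)
  qed
  have first: "?A (\<gamma>' s) = 0" if "s \<in> I" for s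
    using zero[of \<gamma> \<gamma>' s C] assms(2) line that by (simp add: C2_derivatives_def)
  show "?A (\<gamma>' s) = 0" by (rule first[OF assms(4)])
  show "?A (\<gamma>'' s) = 0"
    using zero[of \<gamma>' \<gamma>'' s 0] assms(2,4) first by (simp add: C2_derivatives_def)
qed

lemma explicit_flow_eq:
  "explicit_flow v w m t s =
     ((m * (exp (2 * t) - 1) * v + 2 * s) / translation_denominator w t,
      dilation w t * (m + s * (w - 1) / v))"
  by (simp add: explicit_flow_def translation_denominator_def dilation_def Let_def algebra_simps)

lemma explicit_flow_0: "explicit_flow v w m 0 s = (s, m + s * (w - 1) / v)"
  by (simp add: explicit_flow_def)

context
  fixes v w :: real
  assumes v: "v \<noteq> 0" and unit: "v\<^sup>2 + w\<^sup>2 = 1"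
begin

lemma w_bounds: "w < 1" "- 1 < w"
proof -
  have "w\<^sup>2 < 1" using v unit by (smt (verit) zero_less_power2)
  then show "w < 1" "- 1 < w" by (auto simp: abs_square_less_1)
qed

lemma translation_denominator_pos: "translation_denominator w t > 0"
  using w_bounds by (simp add: translation_denominator_def add_pos_pos)

lemma dilation_pos: "dilation w t > 0"
  using translation_denominator_pos by (simp add: dilation_def)

lemma geodesic_translation_has_vector_derivative:
  "((\<lambda>\<tau>. geodesic_translation v w \<tau> p) has_vector_derivative
     (v * (dilation w t)\<^sup>2 * snd p,
      dilation w t * ((1 + w - (1 - w) * exp (2 * t)) / translation_denominator w t) * snd p))
   (at t within J)"
proof -
  let ?D = "translation_denominator w"
  have D: "?D t \<noteq> 0" using translation_denominator_pos[of t] by simp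
  have E: "exp (2 * t) = (exp t)\<^sup>2" "exp (t * 2) = (exp t)\<^sup>2"
    using exp_double[of t] by (simp_all add: mult.commute)
  have dD: "(?D has_real_derivative 2 * (exp t)\<^sup>2 * (1 - w)) (at t within J)"
    unfolding translation_denominator_def[abs_def] E(1)[symmetric]
    by (auto intro!: derivative_eq_intros)
  have "(shear v w has_real_derivative v * (dilation w t)\<^sup>2) (at t within J)"
    unfolding shear_def[abs_def]
    by (rule derivative_eq_intros dD refl D)+
      (use D in \<open>simp add: dilation_def power_divide E power2_eq_square,
        simp add: translation_denominator_def E field_simps, algebra\<close>)
  moreover have "(dilation w has_real_derivative
      dilation w t * ((1 + w - (1 - w) * exp (2 * t)) / ?D t)) (at t within J)"
    unfolding dilation_def[abs_def]
    by (rule derivative_eq_intros dD refl D)+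
      (use D in \<open>simp add: E power2_eq_square,
        simp add: translation_denominator_def E field_simps, algebra\<close>)
  ultimately show ?thesis
    unfolding geodesic_translation_eq
    by (intro has_vector_derivative_Pair)
      (auto intro!: derivative_eq_intros simp flip: has_real_derivative_iff_has_vector_derivative)
qed

lemma translated_curve_C2:
  assumes "open I" "C2_derivatives I \<gamma> \<gamma>' \<gamma>''"
    and "\<And>s. s \<in> I \<Longrightarrow> \<delta> s = geodesic_translation v w t (\<gamma> s)"
  shows "C2_derivatives I \<delta> (\<lambda>s. geodesic_translation v w t (\<gamma>' s))
    (\<lambda>s. geodesic_translation v w t (\<gamma>'' s))"
  using C2_derivatives_cong[OF assms(1)
      C2_derivatives_bounded_linear[OF bounded_linear_geodesic_translation assms(2)] assms(3)]
  by simp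

lemma translated_curve_regular:
  assumes "regular_curve I \<gamma>"
    and \<delta>: "\<And>s. s \<in> I \<Longrightarrow> \<delta> s = geodesic_translation v w t (\<gamma> s)"
  shows "regular_curve I \<delta>"
proof -
  obtain \<gamma>' \<gamma>'' where *: "open I" "is_interval I" "I \<noteq> {}" "\<gamma> ` I \<subseteq> upper_half_plane"
    "C2_derivatives I \<gamma> \<gamma>' \<gamma>''" "\<And>s. s \<in> I \<Longrightarrow> \<gamma>' s \<noteq> 0"
    using assms(1) unfolding regular_curve_iff_C2 by blast
  have "\<delta> ` I \<subseteq> upper_half_plane"
    using *(4) dilation_pos \<delta> by (auto simp: upper_half_plane_def geodesic_translation_eq image_subset_iff)
  moreover have "geodesic_translation v w t (\<gamma>' s) \<noteq> 0" if "s \<in> I" for s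
    using *(6)[OF that] dilation_pos[of t]
    by (auto simp: geodesic_translation_eq zero_prod_def prod_eq_iff)
  ultimately show ?thesis
    using * translated_curve_C2[OF *(1,5) \<delta>] unfolding regular_curve_iff_C2 by blast
qed

text \<open>
  The flow equation at time \<open>t\<close> in terms of the initial curve alone. The condition on \<open>J\<close> makes
  the derivative in time, one-sided at an end point of \<open>J\<close>, unique.
\<close>

lemma translated_curve_flow_equation_iff:
  assumes I: "open I" and C2: "C2_derivatives I \<gamma> \<gamma>' \<gamma>''" and s: "s \<in> I"
    and y: "snd (\<gamma> s) > 0" and nz: "\<gamma>' s \<noteq> 0"
    and \<Gamma>: "\<And>\<tau> u. u \<in> I \<Longrightarrow> \<Gamma> \<tau> u = geodesic_translation v w \<tau> (\<gamma> u)"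
    and J: "at t within J \<noteq> bot"
    and d: "\<gamma>' s = (x1, y1)" "\<gamma>'' s = (x2, y2)"
  shows "normal_part (\<Gamma> t) s (vector_derivative (\<lambda>\<tau>. \<Gamma> \<tau> s) (at t within J)) =
      curvature (\<Gamma> t) s *\<^sub>R unit_normal (\<Gamma> t) s \<longleftrightarrow>
    2 * (1 - w) * snd (\<gamma> s) * (x1 * y2 - x2 * y1) =
      - ((exp (2 * t) * ((1 - w) * x1 + v * y1)\<^sup>2 + (v * x1 - (1 - w) * y1)\<^sup>2) *
         ((1 - w) * x1 + v * y1))"
proof -
  let ?c = "shear v w t" and ?d = "dilation w t"
  let ?e = "(1 + w - (1 - w) * exp (2 * t)) / translation_denominator w t"
  let ?y = "snd (\<gamma> s)"
  have E: "exp (2 * t) = (exp t)\<^sup>2" "exp (t * 2) = (exp t)\<^sup>2"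
    using exp_double[of t] by (simp_all add: mult.commute)
  have D: "translation_denominator w t = (1 - w) * (exp t)\<^sup>2 + (2 - (1 - w))"
    unfolding translation_denominator_def E(1) by (simp add: algebra_simps)
  have D_pos: "(1 - w) * (exp t)\<^sup>2 + (2 - (1 - w)) > 0"
    using translation_denominator_pos[of t] unfolding D .
  have w: "1 + w = 2 - (1 - w)" by simp
  have velocity: "vector_derivative (\<lambda>\<tau>. \<Gamma> \<tau> s) (at t within J) = (v * ?d\<^sup>2 * ?y, ?d * ?e * ?y)"
    unfolding \<Gamma>[OF s]
    by (rule vector_derivative_within[OF J geodesic_translation_has_vector_derivative])
  have equation: "normal_part (\<Gamma> t) s X = curvature (\<Gamma> t) s *\<^sub>R unit_normal (\<Gamma> t) s \<longleftrightarrow>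
      ((x1 + ?c * y1) * snd X - (?d * y1) * fst X) * ((x1 + ?c * y1)\<^sup>2 + (?d * y1)\<^sup>2) =
      (?d * ?y)\<^sup>2 * ((x1 + ?c * y1) * (?d * y2) - (x2 + ?c * y2) * (?d * y1)) +
      (?d * ?y) * (x1 + ?c * y1) * ((x1 + ?c * y1)\<^sup>2 + (?d * y1)\<^sup>2)" for X
    by (rule normal_velocity_eq_curvature_iff[OF I translated_curve_C2[OF I C2 \<Gamma>] s])
      (use d y nz \<Gamma>[OF s] dilation_pos[of t] in \<open>auto simp: geodesic_translation_eq zero_prod_def\<close>)
  have "v\<^sup>2 = (1 - w) * (2 - (1 - w))"
    using unit by (simp add: power2_eq_square algebra_simps)
  from translated_equation_iff[OF this _ D_pos exp_gt_zero y] w_bounds show ?thesis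
    unfolding velocity equation fst_conv snd_conv shear_def dilation_def D E(1) w by simp
qed

text \<open>
  Two different times suffice: \<open>J\<close> contains 0 and some \<open>t \<noteq> 0\<close>, and if \<open>q \<noteq> 0\<close> then
  \<open>exp (2 t) q\<^sup>2 + r\<^sup>2\<close> takes different values at these times.
\<close>

lemma evolving_curve_tangent:
  assumes evolves: "evolves_by_geodesic_translations J I v w \<gamma>" and s: "s \<in> I"
    and I: "open I" and C2: "C2_derivatives I \<gamma> \<gamma>' \<gamma>''"
    and y: "snd (\<gamma> s) > 0" and nz: "\<gamma>' s \<noteq> 0"
  shows "(1 - w) * fst (\<gamma>' s) + v * snd (\<gamma>' s) = 0"
proof (rule ccontr)
  obtain x1 y1 x2 y2 where d: "\<gamma>' s = (x1, y1)" "\<gamma>'' s = (x2, y2)" by fastforce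
  define q where "q = (1 - w) * x1 + v * y1"
  define r where "r = v * x1 - (1 - w) * y1"
  assume "\<not> ?thesis"
  then have q: "q \<noteq> 0" by (simp add: d q_def)
  have J: "is_interval J" "0 \<in> J" "interior J \<noteq> {}"
    and flow: "\<And>t. t \<in> J \<Longrightarrow>
      normal_part (\<lambda>u. geodesic_translation v w t (\<gamma> u)) s
        (vector_derivative (\<lambda>\<tau>. geodesic_translation v w \<tau> (\<gamma> s)) (at t within J)) =
      curvature (\<lambda>u. geodesic_translation v w t (\<gamma> u)) s *\<^sub>R
        unit_normal (\<lambda>u. geodesic_translation v w t (\<gamma> u)) s"
    using evolves s unfolding evolves_by_geodesic_translations_def curve_shortening_flow_def by blast+
  have not_single: "J \<noteq> {t}" for t
    using J(3) by auto
  then obtain t where t: "t \<in> J" "t \<noteq> 0" using J(2) by blast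
  have limpt: "at \<tau> within J \<noteq> bot" if "\<tau> \<in> J" for \<tau>
    using connected_imp_perfect[of J \<tau>] J(1) that not_single
    by (simp add: is_interval_connected trivial_limit_within)
  have eq: "2 * (1 - w) * snd (\<gamma> s) * (x1 * y2 - x2 * y1) = - ((exp (2 * \<tau>) * q\<^sup>2 + r\<^sup>2) * q)"
    if "\<tau> \<in> J" for \<tau>
    using translated_curve_flow_equation_iff[OF I C2 s y nz refl limpt[OF that] d] flow[OF that]
    unfolding q_def r_def by blast
  have "(exp (2 * t) * q\<^sup>2 + r\<^sup>2) * q = (exp (2 * 0) * q\<^sup>2 + r\<^sup>2) * q"
    using eq[OF t(1)] eq[OF J(2)] by simp
  then show False using q t by simp
qed

text \<open>
  On a line \<open>a x + v y = C\<close> both \<open>q\<close> and \<open>x' y'' - x'' y'\<close> vanish, so the condition of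
  \<open>translated_curve_flow_equation_iff\<close> reads \<open>0 = 0\<close> at every time. The flow \<open>\<Gamma>\<close> is prescribed
  on \<open>I\<close> only, as the explicit flow after a change of parameter agrees with the translations just there.
\<close>

lemma translated_line_flow:
  assumes reg: "regular_curve I \<gamma>"
    and line: "\<And>s. s \<in> I \<Longrightarrow> (1 - w) * fst (\<gamma> s) + v * snd (\<gamma> s) = C"
    and \<Gamma>: "\<And>t s. s \<in> I \<Longrightarrow> \<Gamma> t s = geodesic_translation v w t (\<gamma> s)"
  shows "curve_shortening_flow UNIV I \<gamma> \<Gamma>"
proof -
  obtain \<gamma>' \<gamma>'' where I: "open I" "\<gamma> ` I \<subseteq> upper_half_plane"
    and C2: "C2_derivatives I \<gamma> \<gamma>' \<gamma>''" and nz: "\<And>s. s \<in> I \<Longrightarrow> \<gamma>' s \<noteq> 0"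
    using reg unfolding regular_curve_iff_C2 by blast
  have flow: "normal_part (\<Gamma> t) s (vector_derivative (\<lambda>\<tau>. \<Gamma> \<tau> s) (at t)) =
      curvature (\<Gamma> t) s *\<^sub>R unit_normal (\<Gamma> t) s" if s: "s \<in> I" for t s
  proof -
    obtain x1 y1 x2 y2 where d: "\<gamma>' s = (x1, y1)" "\<gamma>'' s = (x2, y2)" by fastforce
    note tangent = line_tangent[OF I(1) C2 line s, unfolded d fst_conv snd_conv]
    have W: "x1 * y2 - x2 * y1 = 0"
      using tangent v by algebra
    show ?thesis
      using translated_curve_flow_equation_iff[OF I(1) C2 s _ nz[OF s] \<Gamma>, of t UNIV, OF _ _ _ d]
        I(2) s W tangent
      by (auto simp: upper_half_plane_def image_subset_iff)
  qed
  have "\<Gamma> 0 s = \<gamma> s" if "s \<in> I" for s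
    using \<Gamma>[OF that, of 0] by (simp add: geodesic_translation_def)
  moreover have "(\<lambda>\<tau>. \<Gamma> \<tau> s) differentiable (at t)" if "s \<in> I" for t s
    unfolding \<Gamma>[OF that]
    using geodesic_translation_has_vector_derivative differentiableI_vector by blast
  ultimately show ?thesis
    using flow translated_curve_regular[OF reg \<Gamma>]
    unfolding curve_shortening_flow_def by auto
qed

section \<open>The explicit flow\<close>

text \<open>
  The explicit flow translates the line \<open>y = m + s (w - 1) / v\<close>, parametrized by its abscissa.
\<close>

lemma explicit_flow_eq_translation:
  "explicit_flow v w m t s = geodesic_translation v w t (s, m + s * (w - 1) / v)"
proof -
  let ?D = "translation_denominator w t" and ?E = "exp (2 * t)"
  have D: "?D > 0" by (rule translation_denominator_pos)
  have "v * (s * (w - 1) / v) = s * (w - 1)" using v by simp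
  then have "s * ?D + (?E - 1) * v * (m + s * (w - 1) / v) = m * (?E - 1) * v + 2 * s"
    unfolding translation_denominator_def by algebra
  then have "s + shear v w t * (m + s * (w - 1) / v) = (m * (?E - 1) * v + 2 * s) / ?D"
    using D by (simp add: shear_def field_simps)
  then show ?thesis
    by (simp add: explicit_flow_eq geodesic_translation_eq)
qed

text \<open>
  All these half-lines start at the same boundary point: where the height \<open>m + s (w - 1) / v\<close> vanishes,
  the abscissa is \<open>m v / (1 - w)\<close> at every time, so the flow turns the half-line about its end point.
\<close>

lemma explicit_flow_image:
  "explicit_flow v w m t ` flow_domain v w m =
     half_line (m * v / (1 - w)) (- (v * exp (- t)) / (1 - w))"
proof (intro subset_antisym subsetI)
  let ?D = "translation_denominator w t" and ?h = "\<lambda>s. m + s * (w - 1) / v"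
  have D: "?D > 0" by (rule translation_denominator_pos)
  have w: "1 - w > 0" using w_bounds by simp
  have slope: "fst (explicit_flow v w m t s) =
      m * v / (1 - w) + - (v * exp (- t)) / (1 - w) * snd (explicit_flow v w m t s)" for s
  proof -
    have "v * ?h s = v * m + s * (w - 1)" using v by (simp add: distrib_left)
    then have "(m * (exp (2 * t) - 1) * v + 2 * s) * (1 - w) = m * v * ?D - 2 * (v * ?h s)"
      unfolding translation_denominator_def by algebra
    moreover have "N / d = (M - K / d) / a" if "N * a = M * d - K" "d \<noteq> 0" "a \<noteq> 0" for N M K a d :: real
      using that by (simp add: field_simps)
    ultimately have eq: "(m * (exp (2 * t) - 1) * v + 2 * s) / ?D = (m * v - 2 * (v * ?h s) / ?D) / (1 - w)"
      using D w by simp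
    have "2 * (v * ?h s) / ?D = (exp (- t) * dilation w t) * (v * ?h s)"
      by (simp add: dilation_def exp_minus)
    also have "\<dots> = v * exp (- t) * (dilation w t * ?h s)"
      by (simp only: mult_ac)
    finally show ?thesis
      unfolding explicit_flow_eq fst_conv snd_conv eq by (simp only: diff_divide_distrib) simp
  qed
  {
    fix p assume "p \<in> explicit_flow v w m t ` flow_domain v w m"
    then obtain s where "s \<in> flow_domain v w m" "p = explicit_flow v w m t s" by blast
    then show "p \<in> half_line (m * v / (1 - w)) (- (v * exp (- t)) / (1 - w))"
      using slope[of s] dilation_pos[of t]
      by (simp add: half_line_def upper_half_plane_def flow_domain_def explicit_flow_eq)
  }
  fix p assume p: "p \<in> half_line (m * v / (1 - w)) (- (v * exp (- t)) / (1 - w))"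
  define s where "s = v / (w - 1) * (snd p / dilation w t - m)"
  have h: "?h s = snd p / dilation w t"
    using v w by (simp add: s_def)
  have "snd (explicit_flow v w m t s) = snd p"
    unfolding explicit_flow_eq h using dilation_pos[of t] by simp
  moreover from this have "fst (explicit_flow v w m t s) = fst p"
    using slope[of s] p by (simp add: half_line_def)
  moreover have "s \<in> flow_domain v w m"
    using p dilation_pos[of t] by (simp add: flow_domain_def h half_line_def upper_half_plane_def)
  ultimately show "p \<in> explicit_flow v w m t ` flow_domain v w m"
    by (metis image_eqI prod_eqI)
qed

lemma explicit_flow_C2:
  "C2_derivatives S (explicit_flow v w m t)
     (\<lambda>_. (2 / translation_denominator w t, dilation w t * (w - 1) / v)) (\<lambda>_. 0)"
proof -
  have "(explicit_flow v w m t has_vector_derivative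
      (2 / translation_denominator w t, dilation w t * (w - 1) / v)) (at s)" for s
    unfolding explicit_flow_eq[abs_def]
    using translation_denominator_pos[of t]
    by (intro has_vector_derivative_Pair)
      (auto intro!: derivative_eq_intros simp: v simp flip: has_real_derivative_iff_has_vector_derivative)
  then show ?thesis by (simp add: C2_derivatives_def)
qed

lemma flow_domain_interval:
  "open (flow_domain v w m)" "is_interval (flow_domain v w m)" "flow_domain v w m \<noteq> {}"
proof -
  show "open (flow_domain v w m)"
    unfolding flow_domain_def by (intro open_Collect_less continuous_intros) (use v in auto)
  have "flow_domain v w m = {s. (w - 1) / v * s > - m}"
    by (auto simp: flow_domain_def mult.commute)
  then show "is_interval (flow_domain v w m)"
    using convex_halfspace_gt[of "- m" "(w - 1) / v"] by (simp add: is_interval_convex_1)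
  have "v / (w - 1) * (1 - m) \<in> flow_domain v w m"
    using v w_bounds by (simp add: flow_domain_def)
  then show "flow_domain v w m \<noteq> {}" by blast
qed

lemma explicit_flow_regular: "regular_curve (flow_domain v w m) (explicit_flow v w m t)"
proof -
  have "explicit_flow v w m t ` flow_domain v w m \<subseteq> upper_half_plane"
    unfolding explicit_flow_image half_line_def by blast
  moreover have "(2 / translation_denominator w t, dilation w t * (w - 1) / v) \<noteq> 0"
    using translation_denominator_pos[of t] by (simp add: zero_prod_def)
  ultimately show ?thesis
    using flow_domain_interval explicit_flow_C2 unfolding regular_curve_iff_C2 by blast
qed

lemma explicit_flow_is_curve_shortening_flow:
  "curve_shortening_flow UNIV (flow_domain v w m) (explicit_flow v w m 0) (explicit_flow v w m)"
proof (rule translated_line_flow[OF explicit_flow_regular])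
  fix s
  have "v * (s * (w - 1) / v) = s * (w - 1)" using v by simp
  then show "(1 - w) * fst (explicit_flow v w m 0 s) + v * snd (explicit_flow v w m 0 s) = v * m"
    unfolding explicit_flow_0 fst_conv snd_conv by algebra
qed (simp only: explicit_flow_0, rule explicit_flow_eq_translation)

lemma curvature_explicit_flow:
  assumes s: "s \<in> flow_domain v w m"
  shows "curvature (explicit_flow v w m t) s =
    sgn v * (v / sqrt (v\<^sup>2 + exp (2 * t) * (w - 1)\<^sup>2))"
proof -
  let ?D = "translation_denominator w t"
  have D: "?D > 0" by (rule translation_denominator_pos)
  have E: "exp (2 * t) = (exp t)\<^sup>2" by (rule exp_double)
  have "(2 / ?D)\<^sup>2 + (dilation w t * (w - 1) / v)\<^sup>2 =
      (2 / (?D * v))\<^sup>2 * (v\<^sup>2 + exp (2 * t) * (w - 1)\<^sup>2)"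
    unfolding E dilation_def using D v by (simp add: field_simps) algebra
  then have "sqrt ((2 / ?D)\<^sup>2 + (dilation w t * (w - 1) / v)\<^sup>2) =
      2 / (?D * \<bar>v\<bar>) * sqrt (v\<^sup>2 + exp (2 * t) * (w - 1)\<^sup>2)"
    using D by (simp add: real_sqrt_mult abs_mult)
  moreover have "v\<^sup>2 + exp (2 * t) * (w - 1)\<^sup>2 > 0"
    using v by (simp add: add_pos_nonneg)
  moreover have "curvature (explicit_flow v w m t) s =
      (2 / ?D) / sqrt ((2 / ?D)\<^sup>2 + (dilation w t * (w - 1) / v)\<^sup>2)"
    using curvature_C2[OF flow_domain_interval(1) explicit_flow_C2 s refl, of 0 0 m t]
    by (simp add: zero_prod_def)
  ultimately show ?thesis
    using D v by (simp add: sgn_if)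
qed

lemma explicit_flow_equidistant: "equidistant_line (explicit_flow v w m t ` flow_domain v w m)"
  unfolding explicit_flow_image using v w_bounds by (intro equidistant_line_half_line) simp

lemma explicit_flow_at_top:
  "approaches_set (\<lambda>t. explicit_flow v w m t ` flow_domain v w m)
     (half_line (m * v / (1 - w)) 0) at_top"
  unfolding explicit_flow_image
proof (rule approaches_set_vertical)
  have "((\<lambda>t::real. exp (- t)) \<longlongrightarrow> 0) at_top"
    by (intro filterlim_compose[OF exp_at_bot] filterlim_uminus_at_bot_at_top)
  from tendsto_mult[OF tendsto_const[of "- v / (1 - w)"] this]
  show "((\<lambda>t. - (v * exp (- t)) / (1 - w)) \<longlongrightarrow> 0) at_top"
    by simp
qed

lemma explicit_flow_at_bot:
  "approaches_ideal_boundary (\<lambda>t. explicit_flow v w m t ` flow_domain v w m) at_bot"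
  unfolding explicit_flow_image
proof (rule approaches_ideal_boundary_half_line)
  have "filterlim (\<lambda>t::real. exp (- t)) at_top at_bot"
    by (intro filterlim_compose[OF exp_at_top] filterlim_uminus_at_top_at_bot)
  then have "filterlim (\<lambda>t. \<bar>v / (1 - w)\<bar> * exp (- t)) at_top at_bot"
    using v w_bounds by (intro filterlim_tendsto_pos_mult_at_top[OF tendsto_const]) auto
  then show "filterlim (\<lambda>t. \<bar>- (v * exp (- t)) / (1 - w)\<bar>) at_top at_bot"
    by (simp add: abs_mult)
qed

end

section \<open>Evolution by geodesic translations\<close>

lemma clopen_subset_eq_connected:
  fixes S T :: "'a::topological_space set"
  assumes "connected T" "open S" "S \<noteq> {}" "S \<subseteq> T" "closedin (top_of_set T) S"
  shows "S = T"
  using assms by (metis connected_clopen open_subset)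

text \<open>
  By the mean value theorem the function is injective, and a continuous injective function on an
  interval maps open sets to open sets.
\<close>

lemma open_image_nonzero_derivative:
  fixes f :: "real \<Rightarrow> real"
  assumes I: "open I" "is_interval I"
    and f: "\<And>x. x \<in> I \<Longrightarrow> (f has_real_derivative f' x) (at x)"
    and nz: "\<And>x. x \<in> I \<Longrightarrow> f' x \<noteq> 0"
  shows "open (f ` I)"
proof -
  have ne: "f l \<noteq> f u" if lu: "l \<in> I" "u \<in> I" "l < u" for l u
  proof
    assume "f l = f u"
    have sub: "{l..u} \<subseteq> I"
      using I(2) lu by (metis atLeastAtMost_iff mem_is_interval_1_I subsetI)
    have "(f has_real_derivative f' x) (at x)" if "l \<le> x" "x \<le> u" for x
      using f sub that by auto
    from MVT2[OF \<open>l < u\<close> this] obtain z where z: "l < z" "z < u" "f u - f l = (u - l) * f' z"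
      by blast
    then have "z \<in> I" using sub by auto
    then show False using nz z \<open>f l = f u\<close> by auto
  qed
  have "inj_on f I"
    by (rule linorder_inj_onI') (rule ne)
  moreover have "continuous_on I f"
    using f by (intro continuous_at_imp_continuous_on ballI DERIV_isCont) blast
  ultimately show ?thesis
    using injective_eq_1d_open_map_UNIV I by blast
qed

theorem proposition3p3:
  fixes \<gamma> :: "real \<Rightarrow> real \<times> real" and I J :: "real set" and v w :: real
  assumes "v \<noteq> 0" and "w \<noteq> 0" and "v\<^sup>2 + w\<^sup>2 = 1"
    and "regular_curve I \<gamma>"
    and "evolves_by_geodesic_translations J I v w \<gamma>"
  shows "\<exists>m \<phi>.
    change_of_parameter I \<phi> \<and> \<phi> ` I \<subseteq> flow_domain v w m \<and>
    \<comment> \<open>the flow is the explicit one\<close>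
    (\<forall>t\<in>J. \<forall>s\<in>I. geodesic_translation v w t (\<gamma> s) = explicit_flow v w m t (\<phi> s)) \<and>
    \<comment> \<open>the curve is an equidistant line, all of it unless the curve is a proper piece\<close>
    equidistant_line (explicit_flow v w m 0 ` flow_domain v w m) \<and>
    \<gamma> ` I \<subseteq> explicit_flow v w m 0 ` flow_domain v w m \<and>
    (closedin (top_of_set upper_half_plane) (\<gamma> ` I) \<longrightarrow>
       \<phi> ` I = flow_domain v w m \<and>
       \<gamma> ` I = explicit_flow v w m 0 ` flow_domain v w m) \<and>
    (\<forall>s\<in>I. curvature \<gamma> s = sgn (v * deriv \<phi> s) * (v / sqrt (2 * (1 - w)))) \<and>
    \<comment> \<open>(1)\<close>
    curve_shortening_flow UNIV I \<gamma> (\<lambda>t s. explicit_flow v w m t (\<phi> s)) \<and>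
    curve_shortening_flow UNIV (flow_domain v w m) (explicit_flow v w m 0) (explicit_flow v w m) \<and>
    approaches_set (\<lambda>t. explicit_flow v w m t ` flow_domain v w m)
      ((\<lambda>s. (m * v / (1 - w), s)) ` {0<..}) at_top \<and>
    approaches_ideal_boundary (\<lambda>t. explicit_flow v w m t ` flow_domain v w m) at_bot \<and>
    \<comment> \<open>(2)\<close>
    (\<forall>t. equidistant_line (explicit_flow v w m t ` flow_domain v w m) \<and>
       (\<forall>s\<in>flow_domain v w m. curvature (explicit_flow v w m t) s =
          sgn v * (v / sqrt (v\<^sup>2 + exp (2 * t) * (w - 1)\<^sup>2))))"
proof -
  note v = \<open>v \<noteq> 0\<close> and unit = \<open>v\<^sup>2 + w\<^sup>2 = 1\<close>
  have w: "w < 1" using w_bounds(1)[OF v unit] .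
  obtain \<gamma>' \<gamma>'' where I: "open I" "is_interval I" "I \<noteq> {}" and up: "\<gamma> ` I \<subseteq> upper_half_plane"
    and C2: "C2_derivatives I \<gamma> \<gamma>' \<gamma>''" and nz: "\<And>s. s \<in> I \<Longrightarrow> \<gamma>' s \<noteq> 0"
    using \<open>regular_curve I \<gamma>\<close> unfolding regular_curve_iff_C2 by blast
  have pos: "snd (\<gamma> s) > 0" if "s \<in> I" for s
    using up that by (auto simp: upper_half_plane_def image_subset_iff)
  have tangent: "(1 - w) * fst (\<gamma>' s) + v * snd (\<gamma>' s) = 0" if "s \<in> I" for s
    by (rule evolving_curve_tangent[OF v unit assms(5) that I(1) C2 pos[OF that] nz[OF that]])
  have horizontal: "fst (\<gamma>' s) \<noteq> 0" if "s \<in> I" for s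
    using tangent[OF that] nz[OF that] v by (auto simp: prod_eq_iff)

  \<comment> \<open>At time 0 the explicit flow is parametrized by the abscissa, which forces the change of parameter.\<close>
  define \<phi> where "\<phi> s = fst (\<gamma> s)" for s
  have d\<phi>: "(\<phi> has_real_derivative fst (\<gamma>' s)) (at s)" if "s \<in> I" for s
    unfolding \<phi>_def[abs_def] has_real_derivative_iff_has_vector_derivative
    using C2 that bounded_linear.has_vector_derivative[OF bounded_linear_fst]
    unfolding C2_derivatives_def by blast
  have param: "change_of_parameter I \<phi>"
  proof -
    have "continuous_on I \<gamma>'"
      using C2 unfolding C2_derivatives_def
      by (metis continuous_at_imp_continuous_on has_vector_derivative_continuous)
    then have "continuous_on I (\<lambda>s. fst (\<gamma>' s))" by (rule continuous_on_fst)
    then have "\<phi> C1_differentiable_on I"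
      using d\<phi> unfolding C1_differentiable_on_def has_real_derivative_iff_has_vector_derivative
      by (intro exI[of _ "\<lambda>s. fst (\<gamma>' s)"]) blast
    moreover have "deriv \<phi> s \<noteq> 0" if "s \<in> I" for s
      using DERIV_imp_deriv[OF d\<phi>[OF that]] horizontal[OF that] by simp
    ultimately show ?thesis by (simp add: change_of_parameter_def)
  qed

  have "\<exists>C. \<forall>s\<in>I. (1 - w) * fst (\<gamma> s) + v * snd (\<gamma> s) = C"
  proof (rule has_field_derivative_zero_constant)
    show "convex I" using I(2) by (simp add: is_interval_convex)
    fix s assume s: "s \<in> I"
    have "((\<lambda>s. snd (\<gamma> s)) has_real_derivative snd (\<gamma>' s)) (at s)"
      unfolding has_real_derivative_iff_has_vector_derivative
      using C2 s bounded_linear.has_vector_derivative[OF bounded_linear_snd]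
      unfolding C2_derivatives_def by blast
    with d\<phi>[OF s] have "((\<lambda>s. (1 - w) * fst (\<gamma> s) + v * snd (\<gamma> s)) has_real_derivative 0) (at s)"
      unfolding \<phi>_def[abs_def] tangent[OF s, symmetric]
      by (intro DERIV_add DERIV_cmult)
    then show "((\<lambda>s. (1 - w) * fst (\<gamma> s) + v * snd (\<gamma> s)) has_real_derivative 0) (at s within I)"
      by (rule has_field_derivative_at_within)
  qed
  then obtain C where C: "\<And>s. s \<in> I \<Longrightarrow> (1 - w) * fst (\<gamma> s) + v * snd (\<gamma> s) = C" by blast
  define m where "m = C / v"
  have snd_\<gamma>: "snd (\<gamma> s) = m + \<phi> s * (w - 1) / v" if "s \<in> I" for s
    using C[OF that] v by (simp add: m_def \<phi>_def field_simps)
  have \<gamma>_eq: "\<gamma> s = explicit_flow v w m 0 (\<phi> s)" if "s \<in> I" for s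
    using snd_\<gamma>[OF that] by (simp add: explicit_flow_0 prod_eq_iff \<phi>_def)
  have flow_eq: "explicit_flow v w m t (\<phi> s) = geodesic_translation v w t (\<gamma> s)" if "s \<in> I" for t s
    using explicit_flow_eq_translation[OF v unit, of m t "\<phi> s"] \<gamma>_eq[OF that]
    by (simp add: explicit_flow_0)
  have \<phi>_sub: "\<phi> ` I \<subseteq> flow_domain v w m"
    using pos snd_\<gamma> by (auto simp: flow_domain_def)

  \<comment> \<open>The image of \<open>\<phi>\<close> is open; if the curve is closed in the half-plane, its preimage under the
    explicit flow at time 0, which is the image of \<open>\<phi>\<close>, is also closed in the connected domain.\<close>
  have whole: "\<phi> ` I = flow_domain v w m" if closed: "closedin (top_of_set upper_half_plane) (\<gamma> ` I)"
  proof (rule clopen_subset_eq_connected)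
    show "connected (flow_domain v w m)"
      using flow_domain_interval(2)[OF v unit] by (rule is_interval_connected)
    show "open (\<phi> ` I)"
      by (rule open_image_nonzero_derivative[OF I(1,2) d\<phi> horizontal])
    show "\<phi> ` I \<noteq> {}" using I by simp
    have "continuous_on (flow_domain v w m) (explicit_flow v w m 0)"
      unfolding explicit_flow_0[abs_def] by (intro continuous_intros) (use v in auto)
    moreover have "explicit_flow v w m 0 \<in> flow_domain v w m \<rightarrow> upper_half_plane"
      by (auto simp: explicit_flow_0 flow_domain_def upper_half_plane_def)
    ultimately have "closedin (top_of_set (flow_domain v w m))
        (flow_domain v w m \<inter> explicit_flow v w m 0 -` (\<gamma> ` I))"
      using closed by (rule continuous_closedin_preimage_gen)
    moreover have "flow_domain v w m \<inter> explicit_flow v w m 0 -` (\<gamma> ` I) = \<phi> ` I"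
    proof (intro subset_antisym subsetI)
      fix x assume "x \<in> flow_domain v w m \<inter> explicit_flow v w m 0 -` (\<gamma> ` I)"
      then obtain s where "s \<in> I" "explicit_flow v w m 0 x = \<gamma> s" by blast
      then have "x = \<phi> s" unfolding explicit_flow_0 \<phi>_def by (metis fst_conv)
      with \<open>s \<in> I\<close> show "x \<in> \<phi> ` I" by blast
    next
      fix x assume "x \<in> \<phi> ` I"
      then obtain s where "s \<in> I" "x = \<phi> s" by blast
      with \<gamma>_eq[of s] \<phi>_sub show "x \<in> flow_domain v w m \<inter> explicit_flow v w m 0 -` (\<gamma> ` I)"
        by (metis IntI image_eqI subsetD vimageI)
    qed
    ultimately show "closedin (top_of_set (flow_domain v w m)) (\<phi> ` I)" by simp
  qed (rule \<phi>_sub)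

  have curv: "curvature \<gamma> s = sgn (v * deriv \<phi> s) * (v / sqrt (2 * (1 - w)))" if s: "s \<in> I" for s
  proof -
    obtain x1 y1 x2 y2 where d: "\<gamma>' s = (x1, y1)" "\<gamma>'' s = (x2, y2)" by fastforce
    note lines = line_tangent[OF I(1) C2 C s, unfolded d fst_conv snd_conv]
    have W: "x1 * y2 - x2 * y1 = 0"
      using lines v by algebra
    have x1: "x1 \<noteq> 0" using horizontal[OF s] d by simp
    \<comment> \<open>Here \<open>v y1 = - (1 - w) x1\<close>, and \<open>v\<^sup>2 + (1 - w)\<^sup>2 = 2 (1 - w)\<close> for a unit vector \<open>(v, w)\<close>.\<close>
    have "v\<^sup>2 * (x1\<^sup>2 + y1\<^sup>2) = x1\<^sup>2 * (2 * (1 - w))"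
      using lines(1) unit by algebra
    then have "\<bar>v\<bar> * sqrt (x1\<^sup>2 + y1\<^sup>2) = \<bar>x1\<bar> * sqrt (2 * (1 - w))"
      by (metis real_sqrt_abs real_sqrt_mult)
    moreover have "sqrt (x1\<^sup>2 + y1\<^sup>2) > 0" "sqrt (2 * (1 - w)) > 0"
      using x1 w by (simp_all add: sum_power2_gt_zero_iff)
    ultimately have "x1 / sqrt (x1\<^sup>2 + y1\<^sup>2) = sgn x1 * (\<bar>v\<bar> / sqrt (2 * (1 - w)))"
      using x1 by (simp add: frac_eq_eq abs_mult sgn_if field_simps split: if_splits)
    then show ?thesis
      unfolding curvature_C2[OF I(1) C2 s d] W DERIV_imp_deriv[OF d\<phi>[OF s]] d
      by (simp add: sgn_mult mult_ac abs_sgn)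
  qed

  have geo: "(\<lambda>s. (m * v / (1 - w), s)) ` {0<..} = half_line (m * v / (1 - w)) 0"
    by (auto simp: half_line_def upper_half_plane_def)
  have image: "\<gamma> ` I = explicit_flow v w m 0 ` \<phi> ` I"
    unfolding image_image using \<gamma>_eq by (rule image_cong[OF refl])
  have flow: "curve_shortening_flow UNIV I \<gamma> (\<lambda>t s. explicit_flow v w m t (\<phi> s))"
    by (rule translated_line_flow[OF v unit assms(4) C flow_eq])
  have at_top: "approaches_set (\<lambda>t. explicit_flow v w m t ` flow_domain v w m)
      ((\<lambda>s. (m * v / (1 - w), s)) ` {0<..}) at_top"
    unfolding geo by (rule explicit_flow_at_top[OF v unit])
  show ?thesis
  proof (rule exI[of _ m], rule exI[of _ \<phi>], intro conjI impI ballI allI)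
    show "\<gamma> ` I \<subseteq> explicit_flow v w m 0 ` flow_domain v w m"
      unfolding image using \<phi>_sub by (rule image_mono)
    show "\<gamma> ` I = explicit_flow v w m 0 ` flow_domain v w m"
      if "closedin (top_of_set upper_half_plane) (\<gamma> ` I)"
      unfolding image whole[OF that] ..
  qed (rule param \<phi>_sub flow_eq[symmetric] curv whole flow
      explicit_flow_equidistant[OF v unit] curvature_explicit_flow[OF v unit]
      explicit_flow_is_curve_shortening_flow[OF v unit]
      at_top explicit_flow_at_bot[OF v unit]; assumption)+
qed

end
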